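(* Let $\gamma>0$, $\Delta t>0$, let $k_2,k_3$ be positive integers, and let $D_\circ,D_\diamond,M$ be a one-dimensional periodic upwind SBP operator with $\mathtt{ndof}$ degrees of freedom ($\{D_\circ,D_\diamond\}=\{D_+,D_-\}$). Let $g=g_\cup+g_\cap$ with $g_\cup(c)=\frac{c^4+1}{4}$ and $g_\cap(c)=-\frac{c^2}{2}$. Consider a globally stiffly accurate IMEX Runge-Kutta scheme of type II with $s$ stages and coefficients $\widetilde\alpha,\widehat{\widetilde A}$ (explicit part) and $\alpha,\widehat A$ (implicit part), where $\widehat A$ is invertible. For $\varepsilon>0$ consider the fully discrete scheme for $(\varsigma,\mathbf q,w,\mathbf p,\varphi)$, given, for each $n\ge0$, by the stage equations $$\vec\varsigma=\varsigma^n-\Delta t\,\alpha D_\circ\frac{\mathbf q^n}{\varepsilon^{k_3}}-\Delta t\,\widehat A D_\circ\frac{\vec{\mathbf q}}{\varepsilon^{k_3}},$$ $$\vec{\mathbf q}=\mathbf q^n-\Delta t\,\widetilde\alpha D_\diamond g_\cap'(\varsigma^n)-\Delta t\,\widehat{\widetilde A}D_\diamond g_\cap'(\vec\varsigma)-\Delta t\,\alpha D_\diamond g_\cup'(\varsigma^n)-\Delta t\,\widehat A D_\diamond g_\cup'(\vec\varsigma)-\Delta t\,\alpha D_\diamond\frac{\varsigma^n-\varphi^n}{\varepsilon}-\Delta t\,\widehat A D_\diamond\frac{\vec\varsigma-\vec\varphi}{\varepsilon}-\Delta t\,\alpha\frac{\mathbf q^n}{\varepsilon^{k_3}}-\Delta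 t\,\widehat A\frac{\vec{\mathbf q}}{\varepsilon^{k_3}},$$ $$\vec w=w^n+\gamma\Delta t\,\alpha D_\circ\mathbf p^n+\gamma\Delta t\,\widehat A D_\circ\vec{\mathbf p}+\Delta t\,\alpha\frac{\varsigma^n-\varphi^n}{\varepsilon}+\Delta t\,\widehat A\frac{\vec\varsigma-\vec\varphi}{\varepsilon},$$ $$\vec{\mathbf p}=\mathbf p^n+\Delta t\,\alpha D_\diamond\frac{w^n}{\gamma\varepsilon^{k_2}}+\Delta t\,\widehat A D_\diamond\frac{\vec w}{\gamma\varepsilon^{k_2}},\qquad \vec\varphi=\varphi^n+\Delta t\,\alpha\frac{w^n}{\gamma\varepsilon^{k_2}}+\Delta t\,\widehat A\frac{\vec w}{\gamma\varepsilon^{k_2}},$$ with the values at time level $n+1$ equal to the last stage. Assume that all unknowns (time-level and stage values) can be written in terms of a Hilbert expansion in $\varepsilon$, e.g. $\vec\varsigma=\vec\varsigma_0+\varepsilon\vec\varsigma_1+\varepsilon^2\vec\varsigma_2+\cdots$. Assume the initial conditions are well-prepared in the sense that $$\mathbf q^0=\mathcal O(\varepsilon^{k_3}),\qquad w^0=\mathcal O(\varepsilon^{k_2}),\qquad \mathbf p^0=D_\diamond\varphi^0+\mathcal O(\varepsilon),$$ and, if $\alpha\ne0$, additionally $\varphi^0=\varsigma^0+\mathcal O(\varepsilon)$. Then, for $\varepsilon\to0$, the scheme reduces to a discretization of the Cahn-Hilliard equation in the sense that $\varsigma_0^n$ is the result of the IMEX Runge-Kutta discretization of $\partial_t c=D_2(g'(c)-\gamma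 D_2c)$ with $D_2=D_\circ D_\diamond$; that is, for every $n\ge 0$, $$\vec\varsigma_0=\varsigma_0^n+\Delta t\,D_2\Big(\widetilde\alpha\,g_\cap'(\varsigma_0^n)+\widehat{\widetilde A}\,g_\cap'(\vec\varsigma_0)+\alpha\big(g_\cup'(\varsigma_0^n)-\gamma D_2\varsigma_0^n\big)+\widehat A\big(g_\cup'(\vec\varsigma_0)-\gamma D_2\vec\varsigma_0\big)\Big),$$ with $\varsigma_0^{n+1}$ equal to the last stage of $\vec\varsigma_0$.
   Context: Periodic upwind SBP operator (one space dimension): matrices $D_+,D_-\in\mathbb R^{\mathtt{ndof}\times\mathtt{ndof}}$ consistent with the first derivative (in particular $D_\pm 1=0$, where $1$ is the vector of ones) and a symmetric positive definite, diagonal matrix $M$ such that $MD_+=-D_-^TM$. The symbol $\circ$ denotes either $+$ or $-$, and $\diamond$ the opposite sign. All unknowns $\varsigma^n,\mathbf q^n,w^n,\mathbf p^n,\varphi^n$ are vectors in $\mathbb R^{\mathtt{ndof}}$; $g_\cup',g_\cap'$ act componentwise. Type II IMEX Runge-Kutta scheme with $s$ stages for $u'=F_E(u)+F_I(u)$: the first stage is $u^{(1)}=u^n$; the collection $\vec u=(u^{(2)},\dots,u^{(s)})$ of the remaining stages solves $\vec u=u^n+\Delta t(\widetilde\alpha F_E(u^n)+\widehat{\widetilde A}F_E(\vec u)+\alpha F_I(u^n)+\widehat A F_I(\vec u))$, where $\widetilde\alpha,\alpha\in\mathbb R^{s-1}$, $\widehat{\widetilde A},\widehat A\in\mathbb R^{(s-1)\times(s-1)}$,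 $\widehat{\widetilde A}$ is strictly lower triangular, and $\widehat A$ is invertible. Here $u^n$ standing alone means $s-1$ copies of $u^n$; coefficient vectors and matrices act on the stage index (Kronecker product with the identity on $\mathbb R^{\mathtt{ndof}}$), and $F_E$, $F_I$, $D_\circ$, $D_\diamond$, $D_2$, $g_\cup'$, $g_\cap'$ act on each stage separately. Globally stiffly accurate (GSA) means $u^{n+1}=u^{(s)}$, i.e. the update equals the last stage. Hilbert expansion: each time-level and stage value is a formal (asymptotic) power series in $\varepsilon$ with nonnegative powers and coefficients independent of $\varepsilon$ (e.g. $\varsigma^n=\varsigma^n_0+\varepsilon\varsigma^n_1+\cdots$), and the scheme holds order by order in $\varepsilon$; $\Delta t$ and the spatial operators do not depend on $\varepsilon$. *)

theory Defs
  imports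
    "HOL-Analysis.Analysis"
    "HOL-Computational_Algebra.Formal_Laurent_Series"
begin

text \<open>
  A grid function is an element of \<open>'a^'n\<close>, where \<open>'n\<close> indexes the degrees of freedom.  The finite
  linearly ordered type \<open>'s\<close> indexes the stages \<open>2, \<dots>, s\<close> of an \<open>s\<close>-stage type II scheme, whose
  first stage is the old value, so \<open>CARD('s) = s - 1\<close>.  A collection of stages is an element \<open>U\<close> of
  \<open>'a^'n^'s\<close>; it is then also a matrix with one row per stage, and the Kronecker product of a
  coefficient matrix \<open>A\<close> with the identity acts on it as \<open>A ** U\<close>.
\<close>

definition map_vec :: "('a \<Rightarrow> 'b) \<Rightarrow> 'a^'k \<Rightarrow> 'b^'k" where
  "map_vec f v = (\<chi> i. f (v $ i))"

definition copies :: "'a^'n \<Rightarrow> 'a^'n^'s" where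
  "copies u = (\<chi> i. u)"

definition stage_outer :: "'a::times^'s \<Rightarrow> 'a^'n \<Rightarrow> 'a^'n^'s"  (infixl \<open>\<otimes>\<^sub>s\<close> 70) where
  "a \<otimes>\<^sub>s u = (\<chi> i. a $ i *s u)"

definition stage_scale :: "'a::times \<Rightarrow> 'a^'n^'s \<Rightarrow> 'a^'n^'s"  (infixr \<open>\<cdot>\<^sub>s\<close> 67) where
  "x \<cdot>\<^sub>s U = map_vec (\<lambda>v. x *s v) U"

definition last_stage :: "'a^'s::{finite,linorder} \<Rightarrow> 'a" where
  "last_stage U = U $ Max UNIV"

definition strictly_lower_triangular :: "'a::zero^'s::{finite,linorder}^'s::{finite,linorder} \<Rightarrow> bool" where
  "strictly_lower_triangular A \<longleftrightarrow> (\<forall>i j. i \<le> j \<longrightarrow> A $ i $ j = 0)"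


subsection \<open>Periodic upwind SBP operators\<close>

text \<open>
  Of the consistency with the first derivative, only the exactness for constants is independent of
  an underlying grid.
\<close>

definition periodic_upwind_SBP :: "real^'n^'n \<Rightarrow> real^'n^'n \<Rightarrow> real^'n^'n \<Rightarrow> bool" where
  "periodic_upwind_SBP Dp Dm M \<longleftrightarrow>
     Dp *v 1 = 0 \<and> Dm *v 1 = 0 \<and>
     (\<forall>i j. i \<noteq> j \<longrightarrow> M $ i $ j = 0) \<and>
     transpose M = M \<and> (\<forall>x. x \<noteq> 0 \<longrightarrow> x \<bullet> (M *v x) > 0) \<and>
     M ** Dp = - (transpose Dm ** M)"


subsection \<open>The double-well potential and its splitting\<close>

text \<open>
  Polynomials over an arbitrary field, so that their derivatives can be evaluated both at real
  numbers and at formal series in \<open>\<epsilon>\<close>.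
\<close>

definition g_cup :: "'a::field poly" where
  "g_cup = smult (1 / 4) (monom 1 4 + 1)"

definition g_cap :: "'a::field poly" where
  "g_cap = - smult (1 / 2) (monom 1 2)"

lemma poly_g_cup: "poly g_cup c = (c ^ 4 + 1) / 4"
  by (simp add: g_cup_def poly_monom)

lemma poly_g_cap: "poly g_cap c = - (c ^ 2 / 2)"
  by (simp add: g_cap_def poly_monom)


subsection \<open>The fully discrete scheme\<close>

text \<open>
  The equations make sense over any field.  Over \<^typ>\<open>real\<close> they are the scheme for a fixed
  \<open>\<epsilon> > 0\<close>; over \<^typ>\<open>real fls\<close> with \<open>\<epsilon> = fls_X\<close> they are the scheme for formal series in \<open>\<epsilon>\<close>,
  required to hold order by order (including the negative orders).
\<close>

definition stage_equations ::
  "'a::field \<Rightarrow> 'a \<Rightarrow> 'a \<Rightarrow> nat \<Rightarrow> nat \<Rightarrow> 'a^'n^'n \<Rightarrow> 'a^'n^'n \<Rightarrow>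
   'a^'s \<Rightarrow> 'a^'s^'s \<Rightarrow> 'a^'s \<Rightarrow> 'a^'s^'s \<Rightarrow>
   'a^'n \<Rightarrow> 'a^'n \<Rightarrow> 'a^'n \<Rightarrow> 'a^'n \<Rightarrow> 'a^'n \<Rightarrow>
   'a^'n^'s \<Rightarrow> 'a^'n^'s \<Rightarrow> 'a^'n^'s \<Rightarrow> 'a^'n^'s \<Rightarrow> 'a^'n^'s \<Rightarrow> bool" where
  "stage_equations \<epsilon> \<gamma> \<Delta>t k2 k3 Do Dd \<alpha>\<^sub>E A\<^sub>E \<alpha> A \<sigma> q w p \<phi> \<sigma>s qs ws ps \<phi>s \<longleftrightarrow>
     \<sigma>s = copies \<sigma>
       - \<Delta>t \<cdot>\<^sub>s \<alpha> \<otimes>\<^sub>s (Do *v ((1 / \<epsilon> ^ k3) *s q))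
       - \<Delta>t \<cdot>\<^sub>s A ** map_vec (\<lambda>v. Do *v ((1 / \<epsilon> ^ k3) *s v)) qs \<and>
     qs = copies q
       - \<Delta>t \<cdot>\<^sub>s \<alpha>\<^sub>E \<otimes>\<^sub>s (Dd *v map_vec (poly (pderiv g_cap)) \<sigma>)
       - \<Delta>t \<cdot>\<^sub>s A\<^sub>E ** map_vec (\<lambda>v. Dd *v map_vec (poly (pderiv g_cap)) v) \<sigma>s
       - \<Delta>t \<cdot>\<^sub>s \<alpha> \<otimes>\<^sub>s (Dd *v map_vec (poly (pderiv g_cup)) \<sigma>)
       - \<Delta>t \<cdot>\<^sub>s A ** map_vec (\<lambda>v. Dd *v map_vec (poly (pderiv g_cup)) v) \<sigma>s
       - \<Delta>t \<cdot>\<^sub>s \<alpha> \<otimes>\<^sub>s (Dd *v ((1 / \<epsilon>) *s (\<sigma> - \<phi>)))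
       - \<Delta>t \<cdot>\<^sub>s A ** map_vec (\<lambda>v. Dd *v ((1 / \<epsilon>) *s v)) (\<sigma>s - \<phi>s)
       - \<Delta>t \<cdot>\<^sub>s \<alpha> \<otimes>\<^sub>s ((1 / \<epsilon> ^ k3) *s q)
       - \<Delta>t \<cdot>\<^sub>s A ** map_vec (\<lambda>v. (1 / \<epsilon> ^ k3) *s v) qs \<and>
     ws = copies w
       + (\<gamma> * \<Delta>t) \<cdot>\<^sub>s \<alpha> \<otimes>\<^sub>s (Do *v p)
       + (\<gamma> * \<Delta>t) \<cdot>\<^sub>s A ** map_vec (\<lambda>v. Do *v v) ps
       + \<Delta>t \<cdot>\<^sub>s \<alpha> \<otimes>\<^sub>s ((1 / \<epsilon>) *s (\<sigma> - \<phi>))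
       + \<Delta>t \<cdot>\<^sub>s A ** map_vec (\<lambda>v. (1 / \<epsilon>) *s v) (\<sigma>s - \<phi>s) \<and>
     ps = copies p
       + \<Delta>t \<cdot>\<^sub>s \<alpha> \<otimes>\<^sub>s (Dd *v ((1 / (\<gamma> * \<epsilon> ^ k2)) *s w))
       + \<Delta>t \<cdot>\<^sub>s A ** map_vec (\<lambda>v. Dd *v ((1 / (\<gamma> * \<epsilon> ^ k2)) *s v)) ws \<and>
     \<phi>s = copies \<phi>
       + \<Delta>t \<cdot>\<^sub>s \<alpha> \<otimes>\<^sub>s ((1 / (\<gamma> * \<epsilon> ^ k2)) *s w)
       + \<Delta>t \<cdot>\<^sub>s A ** map_vec (\<lambda>v. (1 / (\<gamma> * \<epsilon> ^ k2)) *s v) ws"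


subsection \<open>Hilbert expansions\<close>

text \<open>
  A Hilbert expansion of a grid function is an element of \<open>real fps^'n\<close>, the formal variable
  being \<open>\<epsilon>\<close>.  The predicate below is the Landau symbol \<open>u = O(\<epsilon>\<^sup>k)\<close> for such expansions.
\<close>

definition hilbert_coeff :: "nat \<Rightarrow> real fps^'n \<Rightarrow> real^'n" where
  "hilbert_coeff k u = map_vec (\<lambda>f. fps_nth f k) u"

definition O_eps :: "nat \<Rightarrow> real fps^'n \<Rightarrow> bool" where
  "O_eps k u \<longleftrightarrow> (\<forall>j<k. hilbert_coeff j u = 0)"

text \<open>
  The order-by-order stage equations: the real data are embedded as series constant in \<open>\<epsilon>\<close>, and the
  expansions as Laurent series, so that they can be divided by powers of \<open>\<epsilon>\<close>.
\<close>

abbreviation const_vec :: "real^'k \<Rightarrow> real fls^'k" where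
  "const_vec \<equiv> map_vec fls_const"

abbreviation const_mat :: "real^'k^'l \<Rightarrow> real fls^'k^'l" where
  "const_mat \<equiv> map_matrix fls_const"

abbreviation ser :: "real fps^'n \<Rightarrow> real fls^'n" where
  "ser \<equiv> map_vec fps_to_fls"

abbreviation sers :: "real fps^'n^'s \<Rightarrow> real fls^'n^'s" where
  "sers \<equiv> map_matrix fps_to_fls"

definition hilbert_stage_equations ::
  "real \<Rightarrow> real \<Rightarrow> nat \<Rightarrow> nat \<Rightarrow> real^'n^'n \<Rightarrow> real^'n^'n \<Rightarrow>
   real^'s \<Rightarrow> real^'s^'s \<Rightarrow> real^'s \<Rightarrow> real^'s^'s \<Rightarrow>
   real fps^'n \<Rightarrow> real fps^'n \<Rightarrow> real fps^'n \<Rightarrow> real fps^'n \<Rightarrow> real fps^'n \<Rightarrow>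
   real fps^'n^'s \<Rightarrow> real fps^'n^'s \<Rightarrow> real fps^'n^'s \<Rightarrow> real fps^'n^'s \<Rightarrow> real fps^'n^'s \<Rightarrow>
   bool" where
  "hilbert_stage_equations \<gamma> \<Delta>t k2 k3 Do Dd \<alpha>\<^sub>E A\<^sub>E \<alpha> A \<sigma> q w p \<phi> \<sigma>s qs ws ps \<phi>s \<longleftrightarrow>
     stage_equations fls_X (fls_const \<gamma>) (fls_const \<Delta>t) k2 k3 (const_mat Do) (const_mat Dd)
       (const_vec \<alpha>\<^sub>E) (const_mat A\<^sub>E) (const_vec \<alpha>) (const_mat A)
       (ser \<sigma>) (ser q) (ser w) (ser p) (ser \<phi>)
       (sers \<sigma>s) (sers qs) (sers ws) (sers ps) (sers \<phi>s)"


subsection \<open>IMEX discretization of the Cahn--Hilliard equation\<close>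

text \<open>The stages of the type II IMEX scheme for \<open>u' = F\<^sub>E(u) + F\<^sub>I(u)\<close>.\<close>

definition imex_stages ::
  "real \<Rightarrow> real^'s \<Rightarrow> real^'s^'s \<Rightarrow> real^'s \<Rightarrow> real^'s^'s \<Rightarrow>
   (real^'n \<Rightarrow> real^'n) \<Rightarrow> (real^'n \<Rightarrow> real^'n) \<Rightarrow> real^'n \<Rightarrow> real^'n^'s \<Rightarrow> bool" where
  "imex_stages \<Delta>t \<alpha>\<^sub>E A\<^sub>E \<alpha> A FE FI u U \<longleftrightarrow>
     U = copies u + \<Delta>t \<cdot>\<^sub>s (\<alpha>\<^sub>E \<otimes>\<^sub>s FE u + A\<^sub>E ** map_vec FE U + \<alpha> \<otimes>\<^sub>s FI u + A ** map_vec FI U)"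

definition cahn_hilliard_rhs :: "real \<Rightarrow> real^'n^'n \<Rightarrow> real^'n \<Rightarrow> real^'n" where
  "cahn_hilliard_rhs \<gamma> D2 c =
     D2 *v (map_vec (poly (pderiv (g_cup + g_cap))) c - \<gamma> *s (D2 *v c))"

definition cahn_hilliard_E :: "real^'n^'n \<Rightarrow> real^'n \<Rightarrow> real^'n" where
  "cahn_hilliard_E D2 c = D2 *v map_vec (poly (pderiv g_cap)) c"

definition cahn_hilliard_I :: "real \<Rightarrow> real^'n^'n \<Rightarrow> real^'n \<Rightarrow> real^'n" where
  "cahn_hilliard_I \<gamma> D2 c = D2 *v (map_vec (poly (pderiv g_cup)) c - \<gamma> *s (D2 *v c))"

lemma cahn_hilliard_splitting:
  "cahn_hilliard_E D2 c + cahn_hilliard_I \<gamma> D2 c = cahn_hilliard_rhs \<gamma> D2 c"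
proof -
  have "map_vec (poly (pderiv (g_cup + g_cap))) c =
        map_vec (poly (pderiv g_cup)) c + map_vec (poly (pderiv g_cap)) c"
    by (simp add: map_vec_def vec_eq_iff pderiv_add)
  then show ?thesis
    by (simp add: cahn_hilliard_E_def cahn_hilliard_I_def cahn_hilliard_rhs_def
        algebra_simps matrix_vector_right_distrib matrix_vector_mult_diff_distrib)
qed

lemma map_vec_stage_outer:
  fixes D2 :: "real^'n^'n"
  shows "map_vec (\<lambda>v. D2 *v v) (a \<otimes>\<^sub>s u) = a \<otimes>\<^sub>s (D2 *v u)"
  by (simp add: map_vec_def stage_outer_def vec_eq_iff vector_scalar_commute)

lemma map_vec_stage_mult:
  fixes D2 :: "real^'n^'n" and A :: "real^'s^'s" and U :: "real^'n^'s"
  shows "map_vec (\<lambda>v. D2 *v v) (A ** U) = A ** map_vec (\<lambda>v. D2 *v v) U"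
  by (simp add: map_vec_def vec_eq_iff matrix_matrix_mult_def matrix_vector_mult_def
      sum_distrib_left ac_simps) (subst sum.swap, simp)

text \<open>The stages with \<open>D\<^sub>2\<close>, acting on each stage, pulled out of the stage combinations.\<close>

lemma cahn_hilliard_imex_stages_iff:
  fixes D2 :: "real^'n^'n"
  shows "imex_stages \<Delta>t \<alpha>\<^sub>E A\<^sub>E \<alpha> A (cahn_hilliard_E D2) (cahn_hilliard_I \<gamma> D2) c cs \<longleftrightarrow>
    cs = copies c + \<Delta>t \<cdot>\<^sub>s map_vec (\<lambda>v. D2 *v v)
       (\<alpha>\<^sub>E \<otimes>\<^sub>s map_vec (poly (pderiv g_cap)) c
        + A\<^sub>E ** map_matrix (poly (pderiv g_cap)) cs
        + \<alpha> \<otimes>\<^sub>s (map_vec (poly (pderiv g_cup)) c - \<gamma> *s (D2 *v c))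
        + A ** (map_matrix (poly (pderiv g_cup)) cs - \<gamma> \<cdot>\<^sub>s map_vec (\<lambda>v. D2 *v v) cs))"
proof -
  have add: "map_vec (\<lambda>v. D2 *v v) (U + V) =
      map_vec (\<lambda>v. D2 *v v) U + map_vec (\<lambda>v. D2 *v v) V" for U V :: "real^'n^'s"
    by (simp add: map_vec_def vec_eq_iff matrix_vector_right_distrib)
  have I: "map_vec (cahn_hilliard_I \<gamma> D2) cs = map_vec (\<lambda>v. D2 *v v)
      (map_matrix (poly (pderiv g_cup)) cs - \<gamma> \<cdot>\<^sub>s map_vec (\<lambda>v. D2 *v v) cs)"
    by (simp add: map_vec_def map_matrix_def vec_eq_iff cahn_hilliard_I_def stage_scale_def)
  have E: "map_vec (cahn_hilliard_E D2) cs =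
      map_vec (\<lambda>v. D2 *v v) (map_matrix (poly (pderiv g_cap)) cs)"
    by (simp add: map_vec_def map_matrix_def vec_eq_iff cahn_hilliard_E_def)
  show ?thesis
    unfolding imex_stages_def add map_vec_stage_outer
      map_vec_stage_mult I E
    by (simp only: cahn_hilliard_E_def cahn_hilliard_I_def)
qed

end

theory Submission
  imports Defs
begin

text \<open>
  Well-preparedness propagates to the stages, hence to the next time level.  By invertibility
  of \<open>A\<close>, the negative orders of the \<open>\<phi>\<close>-equation give \<open>w = O(\<epsilon>^k2)\<close>, then order \<open>-1\<close> of the
  \<open>w\<close>-equation gives \<open>\<phi>\<^sub>0 = \<sigma>\<^sub>0\<close>, then the negative orders of the \<open>q\<close>-equation give
  \<open>q = O(\<epsilon>^k3)\<close>; and \<open>p - Dd \<phi>\<close> is conserved, since the update of \<open>p\<close> is \<open>Dd\<close> applied to that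
  of \<open>\<phi>\<close>.  At order \<open>0\<close>, the \<open>w\<close>-equation then expresses the stage combination of \<open>\<sigma>\<^sub>1 - \<phi>\<^sub>1\<close> by
  that of \<open>-\<gamma> D2 \<sigma>\<^sub>0\<close>, and the \<open>q\<close>-equation expresses the stage combination of the coefficient of
  \<open>\<epsilon>^k3\<close> in \<open>q\<close>.  Substituting both into the \<open>\<sigma>\<close>-equation gives the Cahn--Hilliard stages.
\<close>

section \<open>Extraction of coefficients from Laurent series\<close>

definition order_coeff :: "int \<Rightarrow> real fls^'n \<Rightarrow> real^'n" where
  "order_coeff m u = map_vec (\<lambda>f. fls_nth f m) u"

definition order_coeffs :: "int \<Rightarrow> real fls^'n^'s \<Rightarrow> real^'n^'s" where
  "order_coeffs m U = map_vec (order_coeff m) U"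

text \<open>Division by \<open>fls_X ^ k\<close> is \<open>fls_shift\<close>. Through it each stiff
  term of the scheme couples two different orders in \<epsilon>.\<close>

lemma one_divide_fls_X_power_mult_nth: "fls_nth (1 / fls_X ^ k * f) m = fls_nth f (m + int k)"
  for f :: "real fls"
  by (metis fls_divide_X_power fls_shift_nth mult_1 times_divide_eq_left)

lemma map_vec_nth: "map_vec f v $ i = f (v $ i)"
  by (simp add: map_vec_def)

lemma map_matrix_row: "map_matrix f U $ i = map_vec f (U $ i)"
  by (simp add: map_vec_def vec_eq_iff)

lemma order_coeff_add: "order_coeff m (u + v) = order_coeff m u + order_coeff m v"
  by (simp add: order_coeff_def map_vec_def vec_eq_iff)

lemma order_coeff_diff: "order_coeff m (u - v) = order_coeff m u - order_coeff m v"
  by (simp add: order_coeff_def map_vec_def vec_eq_iff)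

lemma order_coeff_const_scale: "order_coeff m (fls_const c *s u) = c *s order_coeff m u"
  by (simp add: order_coeff_def map_vec_def vec_eq_iff)

text \<open>Entries constant in \<epsilon> do not mix orders, so the Cauchy products collapse and
  the coefficient passes through the finite sums.\<close>

lemma order_coeff_const_mat_mult: "order_coeff m (const_mat D *v u) = D *v order_coeff m u"
  by (simp add: order_coeff_def map_vec_def vec_eq_iff matrix_vector_mult_def fls_nth_sum)

lemma order_coeff_X_power_scale:
  "order_coeff m ((1 / fls_X ^ k) *s u) = order_coeff (m + int k) u"
  by (simp only: order_coeff_def map_vec_nth vec_eq_iff
      vector_smult_component one_divide_fls_X_power_mult_nth simp_thms)

lemma order_coeff_X_scale: "order_coeff m ((1 / fls_X) *s u) = order_coeff (m + 1) u"
  using order_coeff_X_power_scale[of m 1 u] by simp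

lemma order_coeff_const_X_power_scale:
  assumes "c \<noteq> 0"
  shows "order_coeff m ((1 / (fls_const c * fls_X ^ k)) *s u) = (1 / c) *s order_coeff (m + int k) u"
proof -
  have "1 / (fls_const c * fls_X ^ k) = fls_const (1 / c) * (1 / fls_X ^ k)"
    using assms by (simp add: fls_const_divide_const[symmetric] divide_simps del: fls_divide_X_power)
  then show ?thesis
    by (metis order_coeff_const_scale order_coeff_X_power_scale vector_smult_assoc)
qed

lemma order_coeffs_add: "order_coeffs m (U + V) = order_coeffs m U + order_coeffs m V"
  by (simp add: order_coeffs_def map_vec_def vec_eq_iff order_coeff_add)

lemma order_coeffs_diff: "order_coeffs m (U - V) = order_coeffs m U - order_coeffs m V"
  by (simp add: order_coeffs_def map_vec_def vec_eq_iff order_coeff_diff)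

lemma order_coeffs_copies: "order_coeffs m (copies u) = copies (order_coeff m u)"
  by (simp add: order_coeffs_def copies_def map_vec_def vec_eq_iff)

lemma order_coeffs_const_scale: "order_coeffs m (fls_const c \<cdot>\<^sub>s U) = c \<cdot>\<^sub>s order_coeffs m U"
  by (simp add: order_coeffs_def stage_scale_def map_vec_def vec_eq_iff order_coeff_const_scale)

lemma order_coeffs_const_vec_outer:
  "order_coeffs m (const_vec a \<otimes>\<^sub>s u) = a \<otimes>\<^sub>s order_coeff m u"
  by (simp add: order_coeffs_def stage_outer_def map_vec_def vec_eq_iff order_coeff_const_scale)

lemma order_coeffs_const_mat_mult:
  "order_coeffs m (const_mat A ** U) = A ** order_coeffs m U"
  by (simp add: order_coeffs_def order_coeff_def map_vec_def vec_eq_iff matrix_matrix_mult_def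
      fls_nth_sum)

text \<open>Hilbert expansions have no negative powers. At negative orders the equations therefore
  keep only the shifted stiff terms, which turns them into constraints.\<close>

lemma order_coeff_ser: "order_coeff m (ser u) = (if m < 0 then 0 else hilbert_coeff (nat m) u)"
  by (simp add: order_coeff_def hilbert_coeff_def map_vec_def vec_eq_iff)

lemma order_coeffs_sers:
  "order_coeffs m (sers U) = (if m < 0 then 0 else map_vec (hilbert_coeff (nat m)) U)"
  by (simp add: order_coeffs_def order_coeff_def hilbert_coeff_def map_vec_def vec_eq_iff)

section \<open>Nonlinear terms at orders up to zero\<close>

lemma poly_pderiv_g_cap: "poly (pderiv g_cap) c = - c" for c :: "'a::field_char_0"
  by (simp add: g_cap_def pderiv_minus pderiv_smult pderiv_monom poly_monom)

lemma poly_pderiv_g_cup: "poly (pderiv g_cup) c = c ^ 3" for c :: "'a::field_char_0"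
  by (simp add: g_cup_def pderiv_smult pderiv_add pderiv_monom poly_monom)

lemma order_coeff_g_cap:
  "m < 0 \<Longrightarrow> order_coeff m (map_vec (poly (pderiv g_cap)) (ser u)) = 0"
  "order_coeff 0 (map_vec (poly (pderiv g_cap)) (ser u)) =
     map_vec (poly (pderiv g_cap)) (hilbert_coeff 0 u)"
  by (simp_all add: order_coeff_def hilbert_coeff_def map_vec_def vec_eq_iff
      poly_pderiv_g_cap)

text \<open>The cube of a power series is again a power series, and taking the constant term is
  multiplicative. Coefficients of positive order never enter the argument.\<close>

lemma order_coeff_g_cup:
  "m < 0 \<Longrightarrow> order_coeff m (map_vec (poly (pderiv g_cup)) (ser u)) = 0"
  "order_coeff 0 (map_vec (poly (pderiv g_cup)) (ser u)) =
     map_vec (poly (pderiv g_cup)) (hilbert_coeff 0 u)"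
  by (simp_all add: order_coeff_def hilbert_coeff_def map_vec_def vec_eq_iff
      poly_pderiv_g_cup fps_power_zeroth flip: fps_to_fls_power)

lemma order_coeffs_g_cap:
  "m < 0 \<Longrightarrow> order_coeffs m (map_matrix (poly (pderiv g_cap)) (sers U)) = 0"
  "order_coeffs 0 (map_matrix (poly (pderiv g_cap)) (sers U)) =
     map_matrix (poly (pderiv g_cap)) (map_vec (hilbert_coeff 0) U)"
  by (simp_all add: order_coeffs_def order_coeff_def hilbert_coeff_def map_vec_def
      vec_eq_iff poly_pderiv_g_cap)

lemma order_coeffs_g_cup:
  "m < 0 \<Longrightarrow> order_coeffs m (map_matrix (poly (pderiv g_cup)) (sers U)) = 0"
  "order_coeffs 0 (map_matrix (poly (pderiv g_cup)) (sers U)) =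
     map_matrix (poly (pderiv g_cup)) (map_vec (hilbert_coeff 0) U)"
  by (simp_all add: order_coeffs_def order_coeff_def hilbert_coeff_def map_vec_def
      vec_eq_iff poly_pderiv_g_cup fps_power_zeroth flip: fps_to_fls_power)

section \<open>The scheme order by order\<close>

text \<open>Coefficient extraction is linear and commutes with all constant operators, so each
  1/\<epsilon>^k survives only as a shift of the order. The nonlinear terms stay unevaluated, as
  they are known only for m \<le> 0.\<close>

lemma hilbert_stage_equations_coeffs:
  fixes Do Dd :: "real^'n^'n" and A A\<^sub>E :: "real^'s^'s"
  assumes "hilbert_stage_equations \<gamma> \<Delta>t k2 k3 Do Dd \<alpha>\<^sub>E A\<^sub>E \<alpha> A \<sigma> q w p \<phi> \<sigma>s qs ws ps \<phi>s"
    and "\<gamma> \<noteq> 0"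
  shows
    "order_coeffs m (sers \<sigma>s) = copies (order_coeff m (ser \<sigma>))
       - \<Delta>t \<cdot>\<^sub>s \<alpha> \<otimes>\<^sub>s (Do *v order_coeff (m + int k3) (ser q))
       - \<Delta>t \<cdot>\<^sub>s A ** map_vec (\<lambda>v. Do *v v) (order_coeffs (m + int k3) (sers qs))" (is ?A)
    "order_coeffs m (sers qs) = copies (order_coeff m (ser q))
       - \<Delta>t \<cdot>\<^sub>s \<alpha>\<^sub>E \<otimes>\<^sub>s (Dd *v order_coeff m (map_vec (poly (pderiv g_cap)) (ser \<sigma>)))
       - \<Delta>t \<cdot>\<^sub>s A\<^sub>E ** map_vec (\<lambda>v. Dd *v v)
           (order_coeffs m (map_matrix (poly (pderiv g_cap)) (sers \<sigma>s)))
       - \<Delta>t \<cdot>\<^sub>s \<alpha> \<otimes>\<^sub>s (Dd *v order_coeff m (map_vec (poly (pderiv g_cup)) (ser \<sigma>)))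
       - \<Delta>t \<cdot>\<^sub>s A ** map_vec (\<lambda>v. Dd *v v)
           (order_coeffs m (map_matrix (poly (pderiv g_cup)) (sers \<sigma>s)))
       - \<Delta>t \<cdot>\<^sub>s \<alpha> \<otimes>\<^sub>s (Dd *v order_coeff (m + 1) (ser \<sigma> - ser \<phi>))
       - \<Delta>t \<cdot>\<^sub>s A ** map_vec (\<lambda>v. Dd *v v) (order_coeffs (m + 1) (sers \<sigma>s - sers \<phi>s))
       - \<Delta>t \<cdot>\<^sub>s \<alpha> \<otimes>\<^sub>s order_coeff (m + int k3) (ser q)
       - \<Delta>t \<cdot>\<^sub>s A ** order_coeffs (m + int k3) (sers qs)" (is ?B)
    "order_coeffs m (sers ws) = copies (order_coeff m (ser w))
       + (\<gamma> * \<Delta>t) \<cdot>\<^sub>s \<alpha> \<otimes>\<^sub>s (Do *v order_coeff m (ser p))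
       + (\<gamma> * \<Delta>t) \<cdot>\<^sub>s A ** map_vec (\<lambda>v. Do *v v) (order_coeffs m (sers ps))
       + \<Delta>t \<cdot>\<^sub>s \<alpha> \<otimes>\<^sub>s order_coeff (m + 1) (ser \<sigma> - ser \<phi>)
       + \<Delta>t \<cdot>\<^sub>s A ** order_coeffs (m + 1) (sers \<sigma>s - sers \<phi>s)" (is ?C)
    "order_coeffs m (sers ps) = copies (order_coeff m (ser p))
       + \<Delta>t \<cdot>\<^sub>s \<alpha> \<otimes>\<^sub>s (Dd *v ((1 / \<gamma>) *s order_coeff (m + int k2) (ser w)))
       + \<Delta>t \<cdot>\<^sub>s A ** map_vec (\<lambda>v. Dd *v ((1 / \<gamma>) *s v)) (order_coeffs (m + int k2) (sers ws))" (is ?D)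
    "order_coeffs m (sers \<phi>s) = copies (order_coeff m (ser \<phi>))
       + \<Delta>t \<cdot>\<^sub>s \<alpha> \<otimes>\<^sub>s ((1 / \<gamma>) *s order_coeff (m + int k2) (ser w))
       + \<Delta>t \<cdot>\<^sub>s A ** map_vec (\<lambda>v. (1 / \<gamma>) *s v) (order_coeffs (m + int k2) (sers ws))" (is ?E)
proof -
  note coeff_simps = order_coeffs_add order_coeffs_diff order_coeffs_copies order_coeffs_const_scale
    order_coeffs_const_vec_outer order_coeffs_const_mat_mult order_coeff_const_mat_mult
    order_coeff_X_power_scale order_coeff_X_scale order_coeff_const_X_power_scale[OF assms(2)]
    fls_const_mult_const
  note eqs = assms(1)[unfolded hilbert_stage_equations_def stage_equations_def]
  note eqs = eqs[THEN conjunct1] eqs[THEN conjunct2, THEN conjunct1]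
    eqs[THEN conjunct2, THEN conjunct2, THEN conjunct1]
    eqs[THEN conjunct2, THEN conjunct2, THEN conjunct2, THEN conjunct1]
    eqs[THEN conjunct2, THEN conjunct2, THEN conjunct2, THEN conjunct2]
  \<comment> \<open>Passes from the stage-by-stage nonlinearity of the scheme to the entrywise
    \<open>map_matrix\<close> form used by the coefficient lemmas.\<close>
  have shift_nonlinear: "order_coeffs m (map_vec (\<lambda>v. const_mat Dd *v map_vec f v) U) =
      map_vec (\<lambda>v. Dd *v v) (order_coeffs m (map_matrix f U))" for f and U :: "real fls^'n^'s"
    by (rule vec_eq_iff[THEN iffD2, rule_format])
      (simp only: order_coeffs_def map_vec_nth map_matrix_row coeff_simps)
  have shift_scale: "order_coeffs m (map_vec (\<lambda>v. (1 / fls_X ^ k) *s v) U) =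
      order_coeffs (m + int k) U"
    "order_coeffs m (map_vec (\<lambda>v. (1 / fls_X) *s v) U) = order_coeffs (m + 1) U"
    for k and U :: "real fls^'n^'s"
    by (simp_all only: order_coeffs_def vec_eq_iff map_vec_nth coeff_simps simp_thms)
  have shift_op: "order_coeffs m (map_vec (\<lambda>v. const_mat D *v ((1 / fls_X ^ k) *s v)) U) =
      map_vec (\<lambda>v. D *v v) (order_coeffs (m + int k) U)"
    "order_coeffs m (map_vec (\<lambda>v. const_mat D *v ((1 / fls_X) *s v)) U) =
      map_vec (\<lambda>v. D *v v) (order_coeffs (m + 1) U)"
    "order_coeffs m (map_vec (\<lambda>v. const_mat D *v v) U) =
      map_vec (\<lambda>v. D *v v) (order_coeffs m U)"
    for D :: "real^'n^'n" and k and U :: "real fls^'n^'s"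
    by (simp_all only: order_coeffs_def vec_eq_iff map_vec_nth coeff_simps simp_thms)
  have shift_gamma:
    "order_coeffs m (map_vec (\<lambda>v. (1 / (fls_const \<gamma> * fls_X ^ k)) *s v) U) =
      map_vec (\<lambda>v. (1 / \<gamma>) *s v) (order_coeffs (m + int k) U)"
    "order_coeffs m (map_vec (\<lambda>v. const_mat D *v ((1 / (fls_const \<gamma> * fls_X ^ k)) *s v)) U) =
      map_vec (\<lambda>v. D *v ((1 / \<gamma>) *s v)) (order_coeffs (m + int k) U)"
    for D :: "real^'n^'n" and k and U :: "real fls^'n^'s"
    by (simp_all only: order_coeffs_def vec_eq_iff map_vec_nth coeff_simps simp_thms)
  note all_simps = coeff_simps shift_nonlinear shift_scale shift_op shift_gamma
  show ?A
    by (subst eqs(1)) (simp only: all_simps)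
  show ?B
    \<comment> \<open>A single substitution, because \<open>sers qs\<close> occurs on both sides of
      its own equation and repeated rewriting would loop.\<close>
    by (subst eqs(2)) (simp only: all_simps)
  show ?C
    by (subst eqs(3)) (simp only: all_simps)
  show ?D
    by (subst eqs(4)) (simp only: all_simps)
  show ?E
    by (subst eqs(5)) (simp only: all_simps)
qed

section \<open>One time step of the limit \<epsilon> to 0\<close>

text \<open>The step of the induction over time levels. The leading terms of \<phi> and \<sigma>
  must agree at the old level only if \<alpha> \<noteq> 0, but agree at every stage. Comparing p
  with \<open>Dd\<close> applied to \<phi> rather than to \<sigma> keeps the condition on p
  meaningful for \<alpha> = 0.\<close>

lemma hilbert_stage_step:
  fixes Do Dd :: "real^'n^'n" and A A\<^sub>E :: "real^'s^'s"
    and \<sigma> q w p \<phi> :: "real fps^'n" and \<sigma>s qs ws ps \<phi>s :: "real fps^'n^'s"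
  assumes pos: "\<gamma> > 0" "\<Delta>t > 0" "k2 > 0" "k3 > 0"
    and "invertible A"
    and stages: "hilbert_stage_equations \<gamma> \<Delta>t k2 k3 Do Dd \<alpha>\<^sub>E A\<^sub>E \<alpha> A \<sigma> q w p \<phi> \<sigma>s qs ws ps \<phi>s"
    and q: "O_eps k3 q" and w: "O_eps k2 w"
    and p: "hilbert_coeff 0 p = Dd *v hilbert_coeff 0 \<phi>"
    and \<phi>: "\<alpha> \<noteq> 0 \<Longrightarrow> hilbert_coeff 0 \<phi> = hilbert_coeff 0 \<sigma>"
  defines "c \<equiv> hilbert_coeff 0 \<sigma>" and "cs \<equiv> map_vec (hilbert_coeff 0) \<sigma>s"
  shows "O_eps k3 (qs $ i)" and "O_eps k2 (ws $ i)"
    and "hilbert_coeff 0 (ps $ i) = Dd *v hilbert_coeff 0 (\<phi>s $ i)"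
    and "hilbert_coeff 0 (\<phi>s $ i) = hilbert_coeff 0 (\<sigma>s $ i)"
    and "imex_stages \<Delta>t \<alpha>\<^sub>E A\<^sub>E \<alpha> A (cahn_hilliard_E (Do ** Dd)) (cahn_hilliard_I \<gamma> (Do ** Dd)) c cs"
proof -
  have "\<gamma> \<noteq> 0" using pos by simp
  note eqs = hilbert_stage_equations_coeffs[OF stages \<open>\<gamma> \<noteq> 0\<close>]
  have mult_0: "B ** (0 :: real^'n^'s) = 0" for B :: "real^'s^'s"
    by (simp add: matrix_matrix_mult_def vec_eq_iff)
  \<comment> \<open>Used at every negative order: once only the implicit combination survives, a
    left inverse of \<open>A\<close> makes the stages vanish.\<close>
  have A_cancel: "U = 0" if "\<Delta>t \<cdot>\<^sub>s A ** U = 0" for U :: "real^'n^'s"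
  proof -
    have "A ** U = 0"
      using that pos by (simp add: stage_scale_def vec_eq_iff map_vec_nth)
    moreover obtain B where "B ** A = mat 1"
      using \<open>invertible A\<close> by (auto simp: invertible_def)
    ultimately show ?thesis
      by (metis matrix_mul_assoc matrix_mul_lid mult_0)
  qed
  have outer_0: "a \<otimes>\<^sub>s (0 :: real^'n) = 0" "0 \<otimes>\<^sub>s u = 0" for a :: "real^'s" and u :: "real^'n"
    by (simp_all add: stage_outer_def vec_eq_iff)
  have scale_0: "x \<cdot>\<^sub>s 0 = 0" for x :: real
    by (simp add: stage_scale_def map_vec_def vec_eq_iff)
  have copies_0: "copies 0 = (0 :: real^'n^'s)"
    by (simp add: copies_def vec_eq_iff)
  have op_0: "map_vec (\<lambda>v. D *v v) 0 = (0 :: real^'n^'s)" for D :: "real^'n^'n"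
    by (simp add: map_vec_def vec_eq_iff)
  have scale_add: "x \<cdot>\<^sub>s (U + V) = x \<cdot>\<^sub>s U + x \<cdot>\<^sub>s V" for x and U V :: "real^'n^'s"
    by (simp add: stage_scale_def map_vec_def vec_eq_iff distrib_left)
  have op_add: "map_vec (\<lambda>v. T *v v) (U + V) = map_vec (\<lambda>v. T *v v) U + map_vec (\<lambda>v. T *v v) V"
    for T :: "real^'n^'n" and U V :: "real^'n^'s"
    by (simp add: map_vec_def vec_eq_iff matrix_vector_right_distrib)
  have op_scale: "map_vec (\<lambda>v. T *v v) (x \<cdot>\<^sub>s U) = x \<cdot>\<^sub>s map_vec (\<lambda>v. T *v v) U"
    for T :: "real^'n^'n" and x and U :: "real^'n^'s"
    by (simp add: map_vec_def stage_scale_def vec_eq_iff vector_scalar_commute)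
  have op_copies: "map_vec (\<lambda>v. T *v v) (copies u :: real^'n^'s) = copies (T *v u)"
    for T :: "real^'n^'n" and u
    by (simp add: map_vec_def copies_def vec_eq_iff)
  have op_map: "map_vec (\<lambda>v. T *v v) (map_vec f U) = map_vec (\<lambda>v. T *v f v) U"
    for T :: "real^'n^'n" and f and U :: "real^'n^'s"
    by (simp add: map_vec_def vec_eq_iff)
  let ?Dd = "\<lambda>U::real^'n^'s. map_vec (\<lambda>v. Dd *v v) U"
  let ?Do = "\<lambda>U::real^'n^'s. map_vec (\<lambda>v. Do *v v) U"
  note zero_simps = outer_0 scale_0 copies_0 op_0 matrix_vector_mult_0_right
    mult_0 vector_smult_rzero
  have q0: "order_coeff m (ser q) = 0" if "m < int k3" for m
    using that q by (auto simp: order_coeff_ser O_eps_def)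
  have w0: "order_coeff m (ser w) = 0" if "m < int k2" for m
    using that w by (auto simp: order_coeff_ser O_eps_def)

  have ws0: "order_coeffs m (sers ws) = 0" if "m < int k2" for m
  proof -
    have "map_vec (\<lambda>v. (1 / \<gamma>) *s v) (order_coeffs m (sers ws)) = 0"
      \<comment> \<open>The order m - k2 is negative, so \<phi> and its stages contribute nothing,
        and the shift by k2 leads back to order m of w.\<close>
      using eqs(5)[of "m - int k2"] w0[OF that] that
      by - (rule A_cancel, simp add: order_coeff_ser order_coeffs_sers zero_simps)
    then show ?thesis
      using \<open>\<gamma> \<noteq> 0\<close> by (simp add: vec_eq_iff map_vec_nth)
  qed

  have outer_\<phi>: "\<alpha> \<otimes>\<^sub>s order_coeff 0 (ser \<sigma> - ser \<phi>) = 0"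
    using \<phi> by (cases "\<alpha> = 0")
      (simp_all add: order_coeff_diff order_coeff_ser zero_simps)
  have diff0: "order_coeffs 0 (sers \<sigma>s - sers \<phi>s) = 0"
    \<comment> \<open>At order -1 the terms in w and p are absent, while the division by \<epsilon>
      brings in order 0 of \<sigma> - \<phi>.\<close>
    using eqs(3)[of "- 1"] outer_\<phi>
    by - (rule A_cancel, simp add: order_coeff_ser order_coeffs_sers zero_simps)
  have diff_neg: "order_coeff m (ser \<sigma> - ser \<phi>) = 0" "order_coeffs m (sers \<sigma>s - sers \<phi>s) = 0"
    if "m < 0" for m
    using that by (simp_all add: order_coeff_diff order_coeffs_diff order_coeff_ser order_coeffs_sers)
  have \<phi>s: "map_vec (hilbert_coeff 0) \<phi>s = cs"
    using diff0 by (simp add: order_coeffs_diff order_coeffs_sers cs_def)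

  have qs0: "order_coeffs m (sers qs) = 0" if "m < int k3" for m
  proof -
    \<comment> \<open>At order j of the q-equation the relaxation term carries order m of q. The
      difference \<sigma> - \<phi> enters at order j + 1 \<le> 0, so only j = -1 needs the agreement
      of the leading terms.\<close>
    define j where "j = m - int k3"
    then have "j < 0" "m = j + int k3" using that by auto
    have "\<alpha> \<otimes>\<^sub>s (Dd *v order_coeff (j + 1) (ser \<sigma> - ser \<phi>)) = 0"
    proof (cases "j + 1 = 0")
      case True
      then show ?thesis
        using \<phi> by (cases "\<alpha> = 0")
          (simp_all add: order_coeff_diff order_coeff_ser zero_simps)
    qed (use \<open>j < 0\<close> diff_neg in \<open>simp add: zero_simps\<close>)
    moreover have "order_coeffs (j + 1) (sers \<sigma>s - sers \<phi>s) = 0"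
      using \<open>j < 0\<close> diff0 diff_neg by (cases "j + 1 = 0") auto
    ultimately show ?thesis
      using eqs(2)[of j] q0[OF that] \<open>j < 0\<close> unfolding \<open>m = j + int k3\<close>
      by - (rule A_cancel, simp add: order_coeff_ser order_coeffs_sers order_coeff_g_cap
          order_coeff_g_cup order_coeffs_g_cap order_coeffs_g_cup zero_simps)
  qed

  have ps: "map_vec (hilbert_coeff 0) ps = map_vec (\<lambda>v. Dd *v v) cs"
  proof -
    \<comment> \<open>The coefficients of w at order k2 are unknown, but they occur identically in
      the \<phi>-equation, which absorbs them.\<close>
    have "order_coeffs 0 (sers ps) = copies (Dd *v hilbert_coeff 0 \<phi>)
        + \<Delta>t \<cdot>\<^sub>s ?Dd (\<alpha> \<otimes>\<^sub>s ((1 / \<gamma>) *s order_coeff (int k2) (ser w)))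
        + \<Delta>t \<cdot>\<^sub>s ?Dd (A ** map_vec (\<lambda>v. (1 / \<gamma>) *s v) (order_coeffs (int k2) (sers ws)))"
      using eqs(4)[of 0] p by (simp add: order_coeff_ser map_vec_stage_outer map_vec_stage_mult op_map)
    also have "\<dots> = ?Dd (order_coeffs 0 (sers \<phi>s))"
      using eqs(5)[of 0] by (simp add: order_coeff_ser op_add op_scale op_copies)
    finally have "map_vec (hilbert_coeff 0) ps = ?Dd (map_vec (hilbert_coeff 0) \<phi>s)"
      by (simp add: order_coeffs_sers)
    then show ?thesis by (simp add: \<phi>s)
  qed
  show "O_eps k3 (qs $ i)"
    unfolding O_eps_def
  proof (intro allI impI)
    fix j assume "j < k3"
    then show "hilbert_coeff j (qs $ i) = 0"
      using qs0[of "int j"] by (simp add: order_coeffs_sers vec_eq_iff[of "map_vec _ _"] map_vec_nth)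
  qed
  show "O_eps k2 (ws $ i)"
    unfolding O_eps_def
  proof (intro allI impI)
    fix j assume "j < k2"
    then show "hilbert_coeff j (ws $ i) = 0"
      using ws0[of "int j"] by (simp add: order_coeffs_sers vec_eq_iff[of "map_vec _ _"] map_vec_nth)
  qed
  show \<phi>s_i: "hilbert_coeff 0 (\<phi>s $ i) = hilbert_coeff 0 (\<sigma>s $ i)"
    using arg_cong[OF \<phi>s, of "\<lambda>U. U $ i"] by (simp add: cs_def map_vec_nth)
  show "hilbert_coeff 0 (ps $ i) = Dd *v hilbert_coeff 0 (\<phi>s $ i)"
    using arg_cong[OF ps, of "\<lambda>U. U $ i"] \<phi>s_i by (simp add: cs_def map_vec_nth)

  \<comment> \<open>Only the combinations \<open>D\<close> and \<open>R\<close> enter at order 0.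
    The individual coefficients, in particular those of the old level, need not be
    determined.\<close>
  define D where "D = \<alpha> \<otimes>\<^sub>s order_coeff 1 (ser \<sigma> - ser \<phi>) + A ** order_coeffs 1 (sers \<sigma>s - sers \<phi>s)"
  define R where "R = \<alpha> \<otimes>\<^sub>s order_coeff (int k3) (ser q) + A ** order_coeffs (int k3) (sers qs)"
  define N where "N = \<alpha>\<^sub>E \<otimes>\<^sub>s map_vec (poly (pderiv g_cap)) c
    + A\<^sub>E ** map_matrix (poly (pderiv g_cap)) cs
    + \<alpha> \<otimes>\<^sub>s map_vec (poly (pderiv g_cup)) c + A ** map_matrix (poly (pderiv g_cup)) cs"
  \<comment> \<open>What the implicit combination of \<open>Do\<close> applied to p becomes after
    inserting the leading term of p.\<close>
  define L where "L = \<alpha> \<otimes>\<^sub>s ((Do ** Dd) *v c) + A ** map_vec (\<lambda>v. (Do ** Dd) *v v) cs"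
  have op_op: "?Do (?Dd U) = map_vec (\<lambda>v. (Do ** Dd) *v v) U" for U
    by (simp add: op_map matrix_vector_mul_assoc)
  have scale_eq_0: "U = 0" if "\<Delta>t \<cdot>\<^sub>s U = 0" for U :: "real^'n^'s"
    using that pos by (simp add: stage_scale_def vec_eq_iff map_vec_nth)
  have D: "D + \<gamma> \<cdot>\<^sub>s L = 0"
  proof -
    \<comment> \<open>At the old level the leading term of p is \<open>Dd *v c\<close> only if
      \<alpha> \<noteq> 0; otherwise the whole term is absent.\<close>
    have "\<alpha> \<otimes>\<^sub>s (Do *v hilbert_coeff 0 p) = \<alpha> \<otimes>\<^sub>s ((Do ** Dd) *v c)"
      using \<phi> p by (cases "\<alpha> = 0")
        (simp_all add: c_def matrix_vector_mul_assoc zero_simps)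
    moreover have "?Do (map_vec (hilbert_coeff 0) ps) = map_vec (\<lambda>v. (Do ** Dd) *v v) cs"
      by (simp add: ps op_op)
    moreover have "(\<gamma> * \<Delta>t) \<cdot>\<^sub>s U = \<Delta>t \<cdot>\<^sub>s \<gamma> \<cdot>\<^sub>s U" for U :: "real^'n^'s"
      by (simp add: stage_scale_def vec_eq_iff map_vec_nth mult.commute mult.left_commute)
    \<comment> \<open>Since k2 > 0, w has no order 0, and the w-equation reduces to a balance of the
      p-terms and the relaxation.\<close>
    ultimately have "\<Delta>t \<cdot>\<^sub>s (D + \<gamma> \<cdot>\<^sub>s L) = 0"
      using eqs(3)[of 0] ws0[of 0] w0[of 0] pos
      by (simp add: order_coeff_ser order_coeffs_sers zero_simps D_def L_def scale_add ac_simps)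
    then show ?thesis by (rule scale_eq_0)
  qed
  have R: "?Dd (N + D) + R = 0"
  proof (rule scale_eq_0)
    show "\<Delta>t \<cdot>\<^sub>s (?Dd (N + D) + R) = 0"
      \<comment> \<open>Likewise k3 > 0 removes q itself at order 0. \<open>Dd\<close> commutes with
        the stage coefficients and is pulled out.\<close>
      using eqs(2)[of 0] qs0[of 0] q0[of 0] pos
      by (simp add: order_coeff_ser order_coeffs_sers order_coeff_g_cap order_coeff_g_cup
          order_coeffs_g_cap order_coeffs_g_cup zero_simps N_def D_def R_def scale_add op_add
          map_vec_stage_outer map_vec_stage_mult algebra_simps flip: c_def cs_def)
  qed
  \<comment> \<open>Applying \<open>Do\<close> to the balance \<open>R\<close> completes
    \<open>Dd\<close> to the second-order operator and eliminates q from the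
    \<sigma>-equation.\<close>
  have Do_R: "\<Delta>t \<cdot>\<^sub>s map_vec (\<lambda>v. (Do ** Dd) *v v) (N + D) = - (\<Delta>t \<cdot>\<^sub>s ?Do R)"
    by (simp only: eq_neg_iff_add_eq_0 R zero_simps flip: op_op op_add scale_add)
  have "cs = copies c - \<Delta>t \<cdot>\<^sub>s ?Do R"
    using eqs(1)[of 0]
    by (simp add: order_coeff_ser order_coeffs_sers R_def scale_add op_add
          map_vec_stage_outer map_vec_stage_mult algebra_simps flip: c_def cs_def)
  also have "\<dots> = copies c + \<Delta>t \<cdot>\<^sub>s map_vec (\<lambda>v. (Do ** Dd) *v v) (N + D)"
    by (simp only: Do_R diff_conv_add_uminus)
  also have "D = - (\<gamma> \<cdot>\<^sub>s L)"
    using D by (simp add: add_eq_0_iff2)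
  \<comment> \<open>Distributing \<open>L\<close> pairs each implicit \<open>g_cup\<close> term with
    its interface term.\<close>
  also have "N + - (\<gamma> \<cdot>\<^sub>s L) = \<alpha>\<^sub>E \<otimes>\<^sub>s map_vec (poly (pderiv g_cap)) c
        + A\<^sub>E ** map_matrix (poly (pderiv g_cap)) cs
        + \<alpha> \<otimes>\<^sub>s (map_vec (poly (pderiv g_cup)) c - \<gamma> *s ((Do ** Dd) *v c))
        + A ** (map_matrix (poly (pderiv g_cup)) cs - \<gamma> \<cdot>\<^sub>s map_vec (\<lambda>v. (Do ** Dd) *v v) cs)"
    by (simp add: N_def L_def stage_outer_def stage_scale_def vec_eq_iff map_vec_nth
        matrix_matrix_mult_def sum_subtractf sum_distrib_left algebra_simps)
  finally show "imex_stages \<Delta>t \<alpha>\<^sub>E A\<^sub>E \<alpha> A (cahn_hilliard_E (Do ** Dd)) (cahn_hilliard_I \<gamma> (Do ** Dd)) c cs"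
    unfolding cahn_hilliard_imex_stages_iff .
qed

section \<open>Induction over the time levels\<close>

theorem theorem21:
  fixes \<gamma> \<Delta>t :: real and k2 k3 :: nat
    and Dp Dm M Do Dd :: "real^'n^'n"
    and \<alpha>\<^sub>E \<alpha> :: "real^'s::{finite,linorder}"
    and A\<^sub>E A :: "real^'s::{finite,linorder}^'s::{finite,linorder}"
    and \<sigma> q w p \<phi> :: "nat \<Rightarrow> real fps^'n"
    and \<sigma>s qs ws ps \<phi>s :: "nat \<Rightarrow> real fps^'n^'s::{finite,linorder}"
  assumes "\<gamma> > 0" and "\<Delta>t > 0" and "k2 > 0" and "k3 > 0"
    and "periodic_upwind_SBP Dp Dm M"
    and "Do = Dp \<and> Dd = Dm \<or> Do = Dm \<and> Dd = Dp"
    and "strictly_lower_triangular A\<^sub>E"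
    and "invertible A"
    and stages: "\<And>n. hilbert_stage_equations \<gamma> \<Delta>t k2 k3 Do Dd \<alpha>\<^sub>E A\<^sub>E \<alpha> A
          (\<sigma> n) (q n) (w n) (p n) (\<phi> n) (\<sigma>s n) (qs n) (ws n) (ps n) (\<phi>s n)"
    and GSA: "\<And>n. \<sigma> (Suc n) = last_stage (\<sigma>s n) \<and> q (Suc n) = last_stage (qs n) \<and>
          w (Suc n) = last_stage (ws n) \<and> p (Suc n) = last_stage (ps n) \<and>
          \<phi> (Suc n) = last_stage (\<phi>s n)"
    and "O_eps k3 (q 0)" and "O_eps k2 (w 0)"
    and "O_eps 1 (p 0 - map_matrix fps_const Dd *v \<phi> 0)"
    and "\<alpha> \<noteq> 0 \<Longrightarrow> O_eps 1 (\<phi> 0 - \<sigma> 0)"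
  defines "D2 \<equiv> Do ** Dd"
    and "\<sigma>0 \<equiv> \<lambda>n. hilbert_coeff 0 (\<sigma> n)"
    and "\<sigma>s0 \<equiv> \<lambda>n. map_vec (hilbert_coeff 0) (\<sigma>s n)"
  shows "\<forall>n.
    \<sigma>s0 n = copies (\<sigma>0 n) + \<Delta>t \<cdot>\<^sub>s map_vec (\<lambda>v. D2 *v v)
       (\<alpha>\<^sub>E \<otimes>\<^sub>s map_vec (poly (pderiv g_cap)) (\<sigma>0 n)
        + A\<^sub>E ** map_matrix (poly (pderiv g_cap)) (\<sigma>s0 n)
        + \<alpha> \<otimes>\<^sub>s (map_vec (poly (pderiv g_cup)) (\<sigma>0 n) - \<gamma> *s (D2 *v \<sigma>0 n))
        + A ** (map_matrix (poly (pderiv g_cup)) (\<sigma>s0 n)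
                - \<gamma> \<cdot>\<^sub>s map_vec (\<lambda>v. D2 *v v) (\<sigma>s0 n)))
    \<and> \<sigma>0 (Suc n) = last_stage (\<sigma>s0 n)"
proof
  fix n
  \<comment> \<open>The last conjunct stays conditional because the initial data provide it only for
    \<alpha> \<noteq> 0.\<close>
  define wp where "wp n \<longleftrightarrow> O_eps k3 (q n) \<and> O_eps k2 (w n) \<and>
      hilbert_coeff 0 (p n) = Dd *v hilbert_coeff 0 (\<phi> n) \<and>
      (\<alpha> \<noteq> 0 \<longrightarrow> hilbert_coeff 0 (\<phi> n) = hilbert_coeff 0 (\<sigma> n))" for n
  have step: "O_eps k3 (qs n $ i) \<and> O_eps k2 (ws n $ i) \<and>
      hilbert_coeff 0 (ps n $ i) = Dd *v hilbert_coeff 0 (\<phi>s n $ i) \<and>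
      hilbert_coeff 0 (\<phi>s n $ i) = hilbert_coeff 0 (\<sigma>s n $ i)"
    "imex_stages \<Delta>t \<alpha>\<^sub>E A\<^sub>E \<alpha> A (cahn_hilliard_E D2) (cahn_hilliard_I \<gamma> D2) (\<sigma>0 n) (\<sigma>s0 n)"
    if "wp n" for n i
    using that hilbert_stage_step[OF assms(1-4) \<open>invertible A\<close> stages[of n]]
    unfolding wp_def D2_def \<sigma>0_def \<sigma>s0_def by blast+
  have "wp n"
  proof (induction n)
    case 0
    have "hilbert_coeff 0 (p 0) = Dd *v hilbert_coeff 0 (\<phi> 0)"
      using \<open>O_eps 1 (p 0 - map_matrix fps_const Dd *v \<phi> 0)\<close>
      by (simp add: O_eps_def hilbert_coeff_def map_vec_def vec_eq_iff matrix_vector_mult_def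
          fps_sum_nth)
    moreover have "hilbert_coeff 0 (\<phi> 0) = hilbert_coeff 0 (\<sigma> 0)" if "\<alpha> \<noteq> 0"
      using \<open>\<alpha> \<noteq> 0 \<Longrightarrow> O_eps 1 (\<phi> 0 - \<sigma> 0)\<close>[OF that]
      by (simp add: O_eps_def hilbert_coeff_def map_vec_def vec_eq_iff)
    ultimately show ?case
      using \<open>O_eps k3 (q 0)\<close> \<open>O_eps k2 (w 0)\<close> by (simp add: wp_def)
  next
    case (Suc n)
    then show ?case
      \<comment> \<open>Every stage is well-prepared, in particular the last one, which is the next
        time level by \<open>GSA\<close>.\<close>
      using step(1)[OF Suc] by (simp add: wp_def GSA last_stage_def)
  qed
  then show "\<sigma>s0 n = copies (\<sigma>0 n) + \<Delta>t \<cdot>\<^sub>s map_vec (\<lambda>v. D2 *v v)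
       (\<alpha>\<^sub>E \<otimes>\<^sub>s map_vec (poly (pderiv g_cap)) (\<sigma>0 n)
        + A\<^sub>E ** map_matrix (poly (pderiv g_cap)) (\<sigma>s0 n)
        + \<alpha> \<otimes>\<^sub>s (map_vec (poly (pderiv g_cup)) (\<sigma>0 n) - \<gamma> *s (D2 *v \<sigma>0 n))
        + A ** (map_matrix (poly (pderiv g_cup)) (\<sigma>s0 n)
                - \<gamma> \<cdot>\<^sub>s map_vec (\<lambda>v. D2 *v v) (\<sigma>s0 n)))
    \<and> \<sigma>0 (Suc n) = last_stage (\<sigma>s0 n)"
    using step(2)[of n] unfolding cahn_hilliard_imex_stages_iff
    by (simp add: \<sigma>0_def \<sigma>s0_def GSA last_stage_def map_vec_nth)
qed

end
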